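(* Consider the three-dimensional curvilinear DGSEM semi-discretization of the compressible Euler equations with gravity for the set of conserved variables $(\varrho,\varrho\vec V,X)$, where $X$ represents any conserved variable that closes the system. The non-conservative numerical volume and surface fluxes $\vec g$ preserve the hydrostatic balance prescribed by a constant background potential temperature $\theta$ under any coordinate mapping if (i) the non-conservative volume flux is of the form $\vec g^{\varrho\vec V,\mathrm{vol}}=\{\!\{\varrho\}\!\}_{\gamma}\,[\![\phi]\!]$; (ii) the pressure term is discretized as $\{\!\{p\}\!\}$; and (iii) the free-stream preservation property is satisfied at the discrete level.
   Context: Momentum equation: $\partial_t(\varrho\vec V)+\nabla\cdot(\varrho\vec V\otimes\vec V)+\nabla p+\varrho\nabla\phi=0$, with $p=K(\varrho\theta)^\gamma$ (constants $K>0$, $\gamma>1$) and a time-independent geopotential $\phi(x,y,z)$ which is a function of physical space evaluated at the nodes, so coincident nodes of neighbouring elements carry the same value of $\phi$. The hydrostatic state with constant potential temperature $\theta>0$ is $\vec V=0$, $\varrho>0$ with $\frac1{\gamma-1}(\varrho^{\gamma-1}-\varrho_0^{\gamma-1})=-\frac1{K\gamma\theta^\gamma}(\phi-\phi_0)$ ($\varrho_0>0,\phi_0$ constant reference values), $p=K(\varrho\theta)^\gamma$. For an ordered pair of nodes with values $a_-$ (first), $a_+$ (second): $\{\!\{a\}\!\}=(a_-+a_+)/2$, $[\![a]\!]=a_+-a_-$, $\{\!\{a\}\!\}_\gamma=\frac{\gamma-1}\gamma\frac{[\![a^\gamma]\!]}{[\![a^{\gamma-1}]\!]}$ for positive values (equal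 to $a$ if $a_\pm=a$). The two-point volume non-conservative term in Cartesian direction $d$ has momentum component $c$ equal to $\delta_{cd}\{\!\{\varrho\}\!\}_\gamma[\![\phi]\!]$; the surface non-conservative flux is of the form (density mean)$\times[\![\phi]\!]$, hence vanishes where $\phi$ is continuous. "The pressure term is discretized as $\{\!\{p\}\!\}$" means that for states at rest the two-point volume and surface momentum fluxes are $f^d_{\varrho v_c}=\delta_{cd}\{\!\{p\}\!\}$. DGSEM: on each hexahedral element mapped from $[-1,1]^3$, with tensor-product Lobatto–Gauss–Legendre nodes $(i,j,k)\in\{0,\dots,N\}^3$, 1D weights $\omega_i$, $\omega_{ij}=\omega_i\omega_j$, $\omega_{ijk}=\omega_i\omega_j\omega_k$, Lagrange derivative matrix $D_{ij}=l_j'(\xi_i)$, $Q_{ij}=\omega_iD_{ij}$ ($\sum_jQ_{ij}=0$), mapping Jacobian $J_{ijk}>0$ and contravariant metric vectors $J\vec a^1,J\vec a^2,J\vec a^3\in\mathbb R^3$ at the nodes, the scheme is $J_{ijk}\omega_{ijk}\dot u_{ijk}=\mathcal F^1_{ijk}+\mathcal F^2_{ijk}+\mathcal F^3_{ijk}$ with $$\mathcal F^1_{ijk}=\omega_{jk}\Big(-2\sum_mQ_{im}\tilde f^{1,\mathrm{vol}}_{(i,m)jk}-\sum_mQ_{im}\tilde g^{1,\mathrm{vol}}_{(i,m)jk}-\delta_{i0}[\overset{\leftrightarrow}f\cdot J\vec a^1]_{0jk}+\delta_{iN}[\overset{\leftrightarrow}f\cdot J\vec a^1]_{Njk}+\delta_{i0}[\tilde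 f^*_{(0,L)jk}+\tfrac12\tilde g^*_{(0,L)jk}]-\delta_{iN}[\tilde f^*_{(N,R)jk}+\tfrac12\tilde g^*_{(N,R)jk}]\Big),$$ and $\mathcal F^2,\mathcal F^3$ defined analogously in the second index (with $\omega_{ik}$, $J\vec a^2$) and third index (with $\omega_{ij}$, $J\vec a^3$). Here $\overset{\leftrightarrow}f=(f^1,f^2,f^3)$, $\overset{\leftrightarrow}f\cdot\vec a=\sum_da_df^d$ (likewise for $g$), $[\overset{\leftrightarrow}f\cdot J\vec a^1]$ uses the exact fluxes, $\tilde f^{1,\mathrm{vol}}_{(i,m)jk}=\overset{\leftrightarrow}f{}^{\mathrm{vol}}(u_{ijk},u_{mjk})\cdot\{\!\{J\vec a^1\}\!\}_{(i,m)jk}$, $\tilde g^{1,\mathrm{vol}}_{(i,m)jk}=\overset{\leftrightarrow}g{}^{\mathrm{vol}}(u_{ijk},u_{mjk})\cdot\{\!\{J\vec a^1\}\!\}_{(i,m)jk}$ (jump $\phi_{mjk}-\phi_{ijk}$), the starred surface quantities are defined by the same formulas with $f^*,g^*$, and $L$, $R$ denote the coincident node of the neighbouring element at the lower/upper face. The mesh is conforming, neighbouring elements have aligned reference directions and the metric vectors $J\vec a^m$ normal to a shared face agree from both sides. Free-stream preservation at the discrete level means the discrete metric identities $\sum_m\big(D_{im}(J\vec a^1)_{mjk}+D_{jm}(J\vec a^2)_{imk}+D_{km}(J\vec a^3)_{ijm}\big)=0$ for all $i,j,k$ (equivalently, since $\sum_mD_{im}=0$, $\sum_m2\big(D_{im}\{\!\{J\vec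 a^1\}\!\}_{(i,m)jk}+D_{jm}\{\!\{J\vec a^2\}\!\}_{i(j,m)k}+D_{km}\{\!\{J\vec a^3\}\!\}_{ij(k,m)}\big)=0$). Preserving the hydrostatic balance means that, for nodal data equal to the hydrostatic state with constant $\theta$, the right-hand side of the momentum equation vanishes at every node of every element. *)

theory Defs
  imports "HOL-Analysis.Analysis" "HOL-Computational_Algebra.Polynomial"
begin

section \<open>One-dimensional Lobatto-Gauss-Legendre operators\<close>

text \<open>Rodrigues' formula.\<close>
definition legendre :: "nat \<Rightarrow> real poly" where
  "legendre n = smult (1 / (2 ^ n * fact n)) ((pderiv ^^ n) ([:-1, 0, 1:] ^ n))"

text \<open>The nodes are the zeros of \<open>(1 - x^2) P_N'(x)\<close> in increasing order; meant for \<open>N \<ge> 1\<close>.\<close>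
definition lgl_nodes :: "nat \<Rightarrow> (nat \<Rightarrow> real) \<Rightarrow> bool" where
  "lgl_nodes N \<xi> \<longleftrightarrow> strict_mono_on {..N} \<xi> \<and>
     \<xi> ` {..N} = {x. poly ([:1, 0, -1:] * pderiv (legendre N)) x = 0}"

definition lagrange :: "nat \<Rightarrow> (nat \<Rightarrow> real) \<Rightarrow> nat \<Rightarrow> real poly" where
  "lagrange N \<xi> j = (\<Prod>m\<in>{..N} - {j}. smult (1 / (\<xi> j - \<xi> m)) [:- \<xi> m, 1:])"

definition lgl_weight :: "nat \<Rightarrow> (nat \<Rightarrow> real) \<Rightarrow> nat \<Rightarrow> real" where
  "lgl_weight N \<xi> i = integral {-1..1} (poly (lagrange N \<xi> i))"

definition Dmat :: "nat \<Rightarrow> (nat \<Rightarrow> real) \<Rightarrow> nat \<Rightarrow> nat \<Rightarrow> real" where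
  "Dmat N \<xi> i j = poly (pderiv (lagrange N \<xi> j)) (\<xi> i)"

definition Qmat :: "nat \<Rightarrow> (nat \<Rightarrow> real) \<Rightarrow> nat \<Rightarrow> nat \<Rightarrow> real" where
  "Qmat N \<xi> i j = lgl_weight N \<xi> i * Dmat N \<xi> i j"


section \<open>Two-point operators\<close>

text \<open>The first argument is the value with index minus, the second the one with index plus.\<close>

definition avg :: "'a::real_vector \<Rightarrow> 'a \<Rightarrow> 'a" where
  "avg a b = (1/2) *\<^sub>R (a + b)"

definition jump :: "real \<Rightarrow> real \<Rightarrow> real" where
  "jump a b = b - a"

definition gamma_mean :: "real \<Rightarrow> real \<Rightarrow> real \<Rightarrow> real" where
  "gamma_mean \<gamma> a b =
     (if a = b then a
      else (\<gamma> - 1) / \<gamma> * (jump (a powr \<gamma>) (b powr \<gamma>) / jump (a powr (\<gamma> - 1)) (b powr (\<gamma> - 1))))"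


section \<open>Curvilinear hexahedral meshes\<close>

text \<open>A node of an element is a multi-index \<open>n\<close> with \<open>n r \<le> N\<close> in each of the three reference
  directions \<open>r\<close>; \<open>n(r := m)\<close> runs along the grid line in direction \<open>r\<close> through \<open>n\<close>.\<close>

type_synonym node = "3 \<Rightarrow> nat"

definition nodes :: "nat \<Rightarrow> node set" where
  "nodes N = {n. \<forall>r. n r \<le> N}"

datatype side = Lower | Upper

text \<open>The Jacobian and the contravariant metric vectors \<open>J a^r\<close> are nodal data. They need not be
  the exact derivatives of the element map: the only property demanded of a discretely computed
  metric is stated separately (\<open>metric_identities\<close>). A neighbour may lie outside \<open>elements\<close>; it
  then only provides the exterior data at a boundary face.\<close>

record 'e mesh =
  elements :: "'e set"
  nbr :: "'e \<Rightarrow> 3 \<Rightarrow> side \<Rightarrow> 'e"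
  elem_map :: "'e \<Rightarrow> real^3 \<Rightarrow> real^3"
  jac :: "'e \<Rightarrow> node \<Rightarrow> real"
  met :: "'e \<Rightarrow> 3 \<Rightarrow> node \<Rightarrow> real^3"

definition position :: "(nat \<Rightarrow> real) \<Rightarrow> 'e mesh \<Rightarrow> 'e \<Rightarrow> node \<Rightarrow> real^3" where
  "position \<xi> M e n = elem_map M e (\<chi> r. \<xi> (n r))"

text \<open>Since reference directions are aligned, the node coinciding with a lower (upper) face node
  has index \<open>N\<close> (index \<open>0\<close>) in the neighbour, the other two indices being the same.\<close>

definition conforming_mesh :: "nat \<Rightarrow> (nat \<Rightarrow> real) \<Rightarrow> 'e mesh \<Rightarrow> bool" where
  "conforming_mesh N \<xi> M \<longleftrightarrow>
     (\<forall>e\<in>elements M. \<forall>n\<in>nodes N. jac M e n > 0) \<and>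
     (\<forall>e\<in>elements M. \<forall>n\<in>nodes N. \<forall>r.
        (n r = 0 \<longrightarrow> position \<xi> M (nbr M e r Lower) (n(r := N)) = position \<xi> M e n \<and>
                    met M (nbr M e r Lower) r (n(r := N)) = met M e r n) \<and>
        (n r = N \<longrightarrow> position \<xi> M (nbr M e r Upper) (n(r := 0)) = position \<xi> M e n \<and>
                    met M (nbr M e r Upper) r (n(r := 0)) = met M e r n))"

definition metric_identities :: "nat \<Rightarrow> (nat \<Rightarrow> real) \<Rightarrow> 'e mesh \<Rightarrow> bool" where
  "metric_identities N \<xi> M \<longleftrightarrow>
     (\<forall>e\<in>elements M. \<forall>n\<in>nodes N.
        (\<Sum>r\<in>UNIV. \<Sum>m\<le>N. Dmat N \<xi> (n r) m *\<^sub>R met M e r (n(r := m))) = 0)"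


section \<open>The DGSEM\<close>

text \<open>\<open>'w\<close> is the type of nodal values, on which fluxes may depend; \<open>'u\<close> is the space of conserved
  variables. The last argument of a flux is its Cartesian direction.\<close>

record ('w, 'u) two_point_fluxes =
  f_vol :: "'w \<Rightarrow> 'w \<Rightarrow> 3 \<Rightarrow> 'u"
  g_vol :: "'w \<Rightarrow> 'w \<Rightarrow> 3 \<Rightarrow> 'u"
  f_surf :: "'w \<Rightarrow> 'w \<Rightarrow> 3 \<Rightarrow> 'u"
  g_surf :: "'w \<Rightarrow> 'w \<Rightarrow> 3 \<Rightarrow> 'u"

definition contract :: "(3 \<Rightarrow> 'u::real_vector) \<Rightarrow> real^3 \<Rightarrow> 'u" where
  "contract f a = (\<Sum>d\<in>UNIV. a $ d *\<^sub>R f d)"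

text \<open>\<open>dgsem_dir f F N \<xi> M w e r n\<close> is the contribution of reference direction \<open>r\<close> at node \<open>n\<close> of
  element \<open>e\<close>, for exact flux \<open>f\<close>, numerical fluxes \<open>F\<close> and nodal values \<open>w\<close>.\<close>

definition dgsem_dir ::
    "('w \<Rightarrow> 3 \<Rightarrow> 'u::real_vector) \<Rightarrow> ('w, 'u) two_point_fluxes \<Rightarrow> nat \<Rightarrow> (nat \<Rightarrow> real) \<Rightarrow> 'e mesh
      \<Rightarrow> ('e \<Rightarrow> node \<Rightarrow> 'w) \<Rightarrow> 'e \<Rightarrow> 3 \<Rightarrow> node \<Rightarrow> 'u" where
  "dgsem_dir f F N \<xi> M w e r n =
    (let contravariant = (\<lambda>h e' n'. contract (h (w e n) (w e' n')) (avg (met M e r n) (met M e' r n')));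
         star = (\<lambda>e' n'. contravariant (f_surf F) e' n' + (1/2) *\<^sub>R contravariant (g_surf F) e' n');
         exact = contract (f (w e n)) (met M e r n)
     in (\<Prod>s\<in>UNIV - {r}. lgl_weight N \<xi> (n s)) *\<^sub>R
        (- 2 *\<^sub>R (\<Sum>m\<le>N. Qmat N \<xi> (n r) m *\<^sub>R contravariant (f_vol F) e (n(r := m)))
         - (\<Sum>m\<le>N. Qmat N \<xi> (n r) m *\<^sub>R contravariant (g_vol F) e (n(r := m)))
         - (if n r = 0 then exact else 0)
         + (if n r = N then exact else 0)
         + (if n r = 0 then star (nbr M e r Lower) (n(r := N)) else 0)
         - (if n r = N then star (nbr M e r Upper) (n(r := 0)) else 0)))"

text \<open>The scheme reads \<open>J \<omega> du/dt = dgsem_sum\<close> at each node, that is \<open>du/dt = dgsem_rate\<close>.\<close>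

definition dgsem_sum ::
    "('w \<Rightarrow> 3 \<Rightarrow> 'u::real_vector) \<Rightarrow> ('w, 'u) two_point_fluxes \<Rightarrow> nat \<Rightarrow> (nat \<Rightarrow> real) \<Rightarrow> 'e mesh
      \<Rightarrow> ('e \<Rightarrow> node \<Rightarrow> 'w) \<Rightarrow> 'e \<Rightarrow> node \<Rightarrow> 'u" where
  "dgsem_sum f F N \<xi> M w e n = (\<Sum>r\<in>UNIV. dgsem_dir f F N \<xi> M w e r n)"

definition dgsem_rate ::
    "('w \<Rightarrow> 3 \<Rightarrow> 'u::real_vector) \<Rightarrow> ('w, 'u) two_point_fluxes \<Rightarrow> nat \<Rightarrow> (nat \<Rightarrow> real) \<Rightarrow> 'e mesh
      \<Rightarrow> ('e \<Rightarrow> node \<Rightarrow> 'w) \<Rightarrow> 'e \<Rightarrow> node \<Rightarrow> 'u" where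
  "dgsem_rate f F N \<xi> M w e n =
     dgsem_sum f F N \<xi> M w e n /\<^sub>R (jac M e n * (\<Prod>r\<in>UNIV. lgl_weight N \<xi> (n r)))"


section \<open>Compressible Euler equations with gravity\<close>

text \<open>Conserved variables: density, momentum, and the variable \<open>X\<close> closing the system. A nodal value
  also contains the geopotential at the node.\<close>

type_synonym euler_state = "real \<times> (real^3) \<times> real"
type_synonym euler_nodal = "euler_state \<times> real"

definition momentum_part :: "euler_state \<Rightarrow> real^3" where
  "momentum_part u = fst (snd u)"

definition mass_density :: "euler_nodal \<Rightarrow> real" where
  "mass_density w = fst (fst w)"

definition momentum :: "euler_nodal \<Rightarrow> real^3" where
  "momentum w = momentum_part (fst w)"

definition velocity :: "euler_nodal \<Rightarrow> real^3" where
  "velocity w = momentum w /\<^sub>R mass_density w"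

definition geopot :: "euler_nodal \<Rightarrow> real" where
  "geopot w = snd w"

text \<open>The choice of \<open>X\<close> enters through the closing relation \<open>\<Theta>\<close>, which gives the potential
  temperature as a function of the nodal value (for \<open>X\<close> a total energy that includes the potential
  energy, \<open>\<Theta>\<close> depends on the geopotential), and through the flux \<open>f\<^sub>X\<close> of \<open>X\<close>.\<close>

definition pressure :: "real \<Rightarrow> real \<Rightarrow> (euler_nodal \<Rightarrow> real) \<Rightarrow> euler_nodal \<Rightarrow> real" where
  "pressure K \<gamma> \<Theta> w = K * (mass_density w * \<Theta> w) powr \<gamma>"

definition euler_flux ::
    "real \<Rightarrow> real \<Rightarrow> (euler_nodal \<Rightarrow> real) \<Rightarrow> (euler_nodal \<Rightarrow> 3 \<Rightarrow> real) \<Rightarrow> euler_nodal \<Rightarrow> 3 \<Rightarrow> euler_state" where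
  "euler_flux K \<gamma> \<Theta> f\<^sub>X w d =
     (momentum w $ d,
      (\<chi> c. momentum w $ c * velocity w $ d + (if c = d then pressure K \<gamma> \<Theta> w else 0)),
      f\<^sub>X w d)"

definition admissible :: "(euler_nodal \<Rightarrow> real) \<Rightarrow> euler_nodal \<Rightarrow> bool" where
  "admissible \<Theta> w \<longleftrightarrow> mass_density w > 0 \<and> \<Theta> w > 0"

definition hydrostatic ::
    "real \<Rightarrow> real \<Rightarrow> (euler_nodal \<Rightarrow> real) \<Rightarrow> real \<Rightarrow> real \<Rightarrow> real \<Rightarrow> euler_nodal \<Rightarrow> bool" where
  "hydrostatic K \<gamma> \<Theta> \<theta> \<rho>\<^sub>0 \<phi>\<^sub>0 w \<longleftrightarrow>
     velocity w = 0 \<and> mass_density w > 0 \<and> \<Theta> w = \<theta> \<and>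
     1 / (\<gamma> - 1) * (mass_density w powr (\<gamma> - 1) - \<rho>\<^sub>0 powr (\<gamma> - 1))
       = - (1 / (K * \<gamma> * \<theta> powr \<gamma>)) * (geopot w - \<phi>\<^sub>0)"

definition noncons_volume_form ::
    "real \<Rightarrow> (euler_nodal \<Rightarrow> real) \<Rightarrow> (euler_nodal \<Rightarrow> euler_nodal \<Rightarrow> 3 \<Rightarrow> euler_state) \<Rightarrow> bool" where
  "noncons_volume_form \<gamma> \<Theta> g \<longleftrightarrow>
     (\<forall>w w' c d. admissible \<Theta> w \<longrightarrow> admissible \<Theta> w' \<longrightarrow>
        momentum_part (g w w' d) $ c =
          (if c = d then gamma_mean \<gamma> (mass_density w) (mass_density w') * jump (geopot w) (geopot w') else 0))"

text \<open>No property of the density mean \<open>\<mu>\<close> is required.\<close>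

definition noncons_surface_form ::
    "(euler_nodal \<Rightarrow> real) \<Rightarrow> (euler_nodal \<Rightarrow> euler_nodal \<Rightarrow> 3 \<Rightarrow> euler_state) \<Rightarrow> bool" where
  "noncons_surface_form \<Theta> g \<longleftrightarrow>
     (\<exists>\<mu> :: real \<Rightarrow> real \<Rightarrow> real. \<forall>w w' c d. admissible \<Theta> w \<longrightarrow> admissible \<Theta> w' \<longrightarrow>
        momentum_part (g w w' d) $ c =
          (if c = d then \<mu> (mass_density w) (mass_density w') * jump (geopot w) (geopot w') else 0))"

definition pressure_average_at_rest ::
    "real \<Rightarrow> real \<Rightarrow> (euler_nodal \<Rightarrow> real) \<Rightarrow> (euler_nodal \<Rightarrow> euler_nodal \<Rightarrow> 3 \<Rightarrow> euler_state) \<Rightarrow> bool" where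
  "pressure_average_at_rest K \<gamma> \<Theta> f \<longleftrightarrow>
     (\<forall>w w' c d. admissible \<Theta> w \<longrightarrow> admissible \<Theta> w' \<longrightarrow> velocity w = 0 \<longrightarrow> velocity w' = 0 \<longrightarrow>
        momentum_part (f w w' d) $ c =
          (if c = d then avg (pressure K \<gamma> \<Theta> w) (pressure K \<gamma> \<Theta> w') else 0))"

text \<open>The geopotential \<open>\<phi>\<close> is a function of physical space, evaluated at the node positions.\<close>

definition nodal_values ::
    "(nat \<Rightarrow> real) \<Rightarrow> 'e mesh \<Rightarrow> (real^3 \<Rightarrow> real) \<Rightarrow> ('e \<Rightarrow> node \<Rightarrow> euler_state) \<Rightarrow> 'e \<Rightarrow> node \<Rightarrow> euler_nodal" where
  "nodal_values \<xi> M \<phi> u e n = (u e n, \<phi> (position \<xi> M e n))"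

definition preserves_hydrostatic_balance ::
    "real \<Rightarrow> real \<Rightarrow> (euler_nodal \<Rightarrow> real) \<Rightarrow> (euler_nodal \<Rightarrow> 3 \<Rightarrow> real)
      \<Rightarrow> (euler_nodal, euler_state) two_point_fluxes \<Rightarrow> nat \<Rightarrow> (nat \<Rightarrow> real) \<Rightarrow> 'e mesh
      \<Rightarrow> (real^3 \<Rightarrow> real) \<Rightarrow> bool" where
  "preserves_hydrostatic_balance K \<gamma> \<Theta> f\<^sub>X F N \<xi> M \<phi> \<longleftrightarrow>
     (\<forall>\<theta> \<rho>\<^sub>0 \<phi>\<^sub>0 u. \<theta> > 0 \<longrightarrow> \<rho>\<^sub>0 > 0 \<longrightarrow>
        (\<forall>e \<in> elements M \<union> {nbr M e r s | e r s. e \<in> elements M}. \<forall>n\<in>nodes N.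
           hydrostatic K \<gamma> \<Theta> \<theta> \<rho>\<^sub>0 \<phi>\<^sub>0 (nodal_values \<xi> M \<phi> u e n)) \<longrightarrow>
        (\<forall>e\<in>elements M. \<forall>n\<in>nodes N.
           momentum_part (dgsem_sum (euler_flux K \<gamma> \<Theta> f\<^sub>X) F N \<xi> M (nodal_values \<xi> M \<phi> u) e n) = 0 \<and>
           momentum_part (dgsem_rate (euler_flux K \<gamma> \<Theta> f\<^sub>X) F N \<xi> M (nodal_values \<xi> M \<phi> u) e n) = 0))"

end

theory Submission
  imports Defs
begin

text \<open>
  For a hydrostatic state with constant potential temperature the two-point volume terms collapse.
  The hydrostatic relation makes the jump of \<open>\<phi>\<close> proportional to the jump of
  \<open>\<rho> powr (\<gamma> - 1)\<close>, and the \<open>\<gamma>\<close>-mean turns the latter into the jump of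
  \<open>\<rho> powr \<gamma>\<close>; hence \<open>gamma_mean \<gamma> \<rho> \<rho>' * (\<phi>' - \<phi>) = p - p'\<close>
  (\<open>gamma_mean_jump_geopot\<close>). So twice the mean of the pressures plus the non-conservative term is
  \<open>2 p\<close>, in which only the pressure at the node under consideration is left. That pressure factors
  out of the sum along a grid line. What remains is the derivative matrix applied to
  twice the averaged metric vectors, which is the derivative of the metric vectors themselves because
  the rows of the derivative matrix sum to zero (\<open>sum_Dmat\<close>).

  At an element face, coincident nodes share \<open>\<phi>\<close>, hence also density and pressure. The numerical
  surface flux is therefore the exact one, the surface non-conservative term vanishes, and the
  boundary terms cancel.

  Altogether, reference direction \<open>r\<close> contributes \<open>- p\<close> times the product of the three weights
  times the derivative of the metric vectors \<open>J a^r\<close> along that direction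
  (\<open>momentum_dgsem_dir\<close>), and the sum over \<open>r\<close> is zero by the metric identities.
\<close>

section \<open>The derivative matrix annihilates constants\<close>

lemma poly_lagrange:
  "poly (lagrange N \<xi> j) x = (\<Prod>m\<in>{..N} - {j}. (x - \<xi> m) / (\<xi> j - \<xi> m))"
  by (simp add: lagrange_def poly_prod diff_divide_distrib)

lemma degree_lagrange:
  assumes "j \<le> N"
  shows "degree (lagrange N \<xi> j) \<le> N"
proof -
  have "degree (lagrange N \<xi> j)
      \<le> (\<Sum>m\<in>{..N} - {j}. degree (smult (1 / (\<xi> j - \<xi> m)) [:- \<xi> m, 1:]))"
    unfolding lagrange_def by (rule order_trans[OF degree_prod_sum_le]) (simp_all add: comp_def)
  also have "\<dots> \<le> (\<Sum>m\<in>{..N} - {j}. 1)"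
    by (intro sum_mono) auto
  also have "\<dots> = N"
    using assms by simp
  finally show ?thesis .
qed

lemma poly_lagrange_node:
  assumes "inj_on \<xi> {..N}" "i \<le> N" "j \<le> N"
  shows "poly (lagrange N \<xi> j) (\<xi> i) = (if i = j then 1 else 0)"
proof (cases "i = j")
  case True
  have "(\<xi> j - \<xi> m) / (\<xi> j - \<xi> m) = 1" if "m \<in> {..N} - {j}" for m
    using that assms by (auto dest: inj_onD)
  with True show ?thesis
    by (simp add: poly_lagrange)
next
  case False
  then show ?thesis
    using assms by (auto simp: poly_lagrange)
qed

lemma sum_lagrange:
  assumes "inj_on \<xi> {..N}"
  shows "(\<Sum>j\<le>N. lagrange N \<xi> j) = 1"
proof (rule poly_eqI_degree[where A = "\<xi> ` {..N}"])
  show "poly (\<Sum>j\<le>N. lagrange N \<xi> j) x = poly 1 x" if x: "x \<in> \<xi> ` {..N}" for x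
  proof -
    obtain i where i: "i \<le> N" "x = \<xi> i"
      using x by auto
    then have "poly (\<Sum>j\<le>N. lagrange N \<xi> j) x = (\<Sum>j\<le>N. if i = j then 1 else 0)"
      using assms by (auto simp: poly_sum poly_lagrange_node intro!: sum.cong)
    also have "\<dots> = 1"
      using i by simp
    finally show ?thesis by simp
  qed
  have card: "card (\<xi> ` {..N}) = Suc N"
    using assms by (simp add: card_image)
  have "degree (\<Sum>j\<le>N. lagrange N \<xi> j) \<le> N"
    by (intro degree_sum_le) (auto intro: degree_lagrange)
  then show "degree (\<Sum>j\<le>N. lagrange N \<xi> j) < card (\<xi> ` {..N})"
    by (simp add: card)
  show "degree (1 :: real poly) < card (\<xi> ` {..N})"
    by (simp add: card)
qed

lemma sum_Dmat:
  assumes "inj_on \<xi> {..N}"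
  shows "(\<Sum>j\<le>N. Dmat N \<xi> i j) = 0"
proof -
  have "(\<Sum>j\<le>N. Dmat N \<xi> i j) = poly (pderiv (\<Sum>j\<le>N. lagrange N \<xi> j)) (\<xi> i)"
    by (simp add: Dmat_def poly_sum higher_pderiv_sum[of 1, simplified])
  then show ?thesis
    by (simp add: sum_lagrange[OF assms])
qed

section \<open>Hydrostatic states\<close>

lemma hydrostatic_admissible:
  assumes "hydrostatic K \<gamma> \<Theta> \<theta> \<rho>\<^sub>0 \<phi>\<^sub>0 w" "\<theta> > 0"
  shows "admissible \<Theta> w" "velocity w = 0" "momentum w = 0"
  using assms by (auto simp: hydrostatic_def admissible_def velocity_def)

lemma hydrostatic_pressure:
  assumes "hydrostatic K \<gamma> \<Theta> \<theta> \<rho>\<^sub>0 \<phi>\<^sub>0 w" "\<theta> > 0"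
  shows "pressure K \<gamma> \<Theta> w = K * \<theta> powr \<gamma> * mass_density w powr \<gamma>"
  using assms by (simp add: hydrostatic_def pressure_def powr_mult)

lemma hydrostatic_jump_geopot:
  assumes "hydrostatic K \<gamma> \<Theta> \<theta> \<rho>\<^sub>0 \<phi>\<^sub>0 w" "hydrostatic K \<gamma> \<Theta> \<theta> \<rho>\<^sub>0 \<phi>\<^sub>0 w'"
    and "K > 0" "\<gamma> > 1" "\<theta> > 0"
  shows "(\<gamma> - 1) * jump (geopot w) (geopot w')
    = - (K * \<gamma> * \<theta> powr \<gamma>) * jump (mass_density w powr (\<gamma> - 1)) (mass_density w' powr (\<gamma> - 1))"
proof -
  define c where "c = K * \<gamma> * \<theta> powr \<gamma>"
  have c: "c \<noteq> 0"
    using assms by (simp add: c_def)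
  have solved: "(\<gamma> - 1) * (geopot v - \<phi>\<^sub>0) = - c * (mass_density v powr (\<gamma> - 1) - \<rho>\<^sub>0 powr (\<gamma> - 1))"
    if "hydrostatic K \<gamma> \<Theta> \<theta> \<rho>\<^sub>0 \<phi>\<^sub>0 v" for v
  proof -
    have "1 / (\<gamma> - 1) * (mass_density v powr (\<gamma> - 1) - \<rho>\<^sub>0 powr (\<gamma> - 1)) = - (1 / c) * (geopot v - \<phi>\<^sub>0)"
      using that by (simp add: hydrostatic_def c_def)
    then show ?thesis
      using c \<open>\<gamma> > 1\<close> by (simp add: field_simps)
  qed
  have "(\<gamma> - 1) * jump (geopot w) (geopot w') = (\<gamma> - 1) * (geopot w' - \<phi>\<^sub>0) - (\<gamma> - 1) * (geopot w - \<phi>\<^sub>0)"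
    by (simp add: jump_def algebra_simps)
  also have "\<dots> = - c * jump (mass_density w powr (\<gamma> - 1)) (mass_density w' powr (\<gamma> - 1))"
    by (simp only: solved[OF assms(1)] solved[OF assms(2)]) (simp add: jump_def algebra_simps)
  finally show ?thesis
    by (simp add: c_def)
qed

lemma powr_eq_iff_base:
  fixes a b s :: real
  assumes "a > 0" "b > 0" "s > 0"
  shows "a powr s = b powr s \<longleftrightarrow> a = b"
  using assms by (metis linorder_neqE_linordered_idom order_less_imp_le order_less_irrefl powr_less_mono2)

lemma hydrostatic_pressure_eq_if_geopot_eq:
  assumes "hydrostatic K \<gamma> \<Theta> \<theta> \<rho>\<^sub>0 \<phi>\<^sub>0 w" "hydrostatic K \<gamma> \<Theta> \<theta> \<rho>\<^sub>0 \<phi>\<^sub>0 w'"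
    and "K > 0" "\<gamma> > 1" "\<theta> > 0" and "geopot w' = geopot w"
  shows "pressure K \<gamma> \<Theta> w' = pressure K \<gamma> \<Theta> w"
proof -
  have "mass_density w powr (\<gamma> - 1) = mass_density w' powr (\<gamma> - 1)"
    using hydrostatic_jump_geopot[OF assms(1-5)] assms(3-6) by (auto simp: jump_def)
  then have "mass_density w = mass_density w'"
    using assms powr_eq_iff_base[of "mass_density w" "mass_density w'" "\<gamma> - 1"]
    by (auto simp: hydrostatic_def)
  then show ?thesis
    using assms by (simp add: hydrostatic_pressure)
qed

lemma gamma_mean_jump_powr:
  assumes "a > 0" "b > 0" "\<gamma> > 1"
  shows "\<gamma> * gamma_mean \<gamma> a b * jump (a powr (\<gamma> - 1)) (b powr (\<gamma> - 1))
    = (\<gamma> - 1) * jump (a powr \<gamma>) (b powr \<gamma>)"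
proof (cases "a = b")
  case True
  then show ?thesis by (simp add: jump_def)
next
  case False
  then have "jump (a powr (\<gamma> - 1)) (b powr (\<gamma> - 1)) \<noteq> 0"
    using assms powr_eq_iff_base[of a b "\<gamma> - 1"] by (simp add: jump_def)
  with False assms(3) show ?thesis
    by (simp add: gamma_mean_def)
qed

text \<open>The discrete form of \<open>\<rho> \<nabla>\<phi> = - \<nabla>p\<close>.\<close>

lemma gamma_mean_jump_geopot:
  assumes "hydrostatic K \<gamma> \<Theta> \<theta> \<rho>\<^sub>0 \<phi>\<^sub>0 w" "hydrostatic K \<gamma> \<Theta> \<theta> \<rho>\<^sub>0 \<phi>\<^sub>0 w'"
    and "K > 0" "\<gamma> > 1" "\<theta> > 0"
  shows "gamma_mean \<gamma> (mass_density w) (mass_density w') * jump (geopot w) (geopot w')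
    = - jump (pressure K \<gamma> \<Theta> w) (pressure K \<gamma> \<Theta> w')"
proof -
  let ?a = "mass_density w" and ?b = "mass_density w'"
  have pos: "?a > 0" "?b > 0"
    using assms by (auto simp: hydrostatic_def)
  have "(\<gamma> - 1) * (gamma_mean \<gamma> ?a ?b * jump (geopot w) (geopot w'))
      = gamma_mean \<gamma> ?a ?b * ((\<gamma> - 1) * jump (geopot w) (geopot w'))"
    by simp
  also have "\<dots> = - (K * \<theta> powr \<gamma>)
      * (\<gamma> * gamma_mean \<gamma> ?a ?b * jump (?a powr (\<gamma> - 1)) (?b powr (\<gamma> - 1)))"
    by (simp add: hydrostatic_jump_geopot[OF assms])
  also have "\<dots> = - (K * \<theta> powr \<gamma>) * ((\<gamma> - 1) * jump (?a powr \<gamma>) (?b powr \<gamma>))"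
    by (simp only: gamma_mean_jump_powr[OF pos \<open>\<gamma> > 1\<close>])
  also have "\<dots> = (\<gamma> - 1) * - jump (pressure K \<gamma> \<Theta> w) (pressure K \<gamma> \<Theta> w')"
    using assms by (simp add: hydrostatic_pressure jump_def algebra_simps)
  finally show ?thesis
    using \<open>\<gamma> > 1\<close> by (simp only: mult_cancel_left) simp
qed

section \<open>Momentum components of the discrete terms\<close>

lemma linear_momentum_part: "linear momentum_part"
  by (rule linearI) (simp_all add: momentum_part_def)

lemmas momentum_part_simps =
  linear_add[OF linear_momentum_part] linear_diff[OF linear_momentum_part]
  linear_neg[OF linear_momentum_part] linear_sum[OF linear_momentum_part]
  linear_scale[OF linear_momentum_part] linear_0[OF linear_momentum_part]

text \<open>A flux whose momentum block is \<open>s\<close> times the identity acts on a direction vector as \<open>s\<close>.\<close>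

lemma momentum_contract_diagonal:
  assumes "\<And>c d. momentum_part (h d) $ c = (if c = d then s else 0)"
  shows "momentum_part (contract h a) = s *\<^sub>R a"
proof (rule vec_eq_iff[THEN iffD2], rule allI)
  fix c
  have "momentum_part (contract h a) $ c = (\<Sum>d\<in>UNIV. a $ d * (if c = d then s else 0))"
    by (simp add: contract_def momentum_part_simps assms)
  also have "\<dots> = (\<Sum>d\<in>UNIV. if c = d then s * a $ d else 0)"
    by (intro sum.cong) auto
  also have "\<dots> = (s *\<^sub>R a) $ c"
    by simp
  finally show "momentum_part (contract h a) $ c = (s *\<^sub>R a) $ c" .
qed

lemma momentum_contract_euler_flux:
  assumes "momentum w = 0"
  shows "momentum_part (contract (euler_flux K \<gamma> \<Theta> f\<^sub>X w) a) = pressure K \<gamma> \<Theta> w *\<^sub>R a"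
  by (rule momentum_contract_diagonal) (simp add: euler_flux_def momentum_part_def assms)

lemma momentum_contract_pressure_average:
  assumes "pressure_average_at_rest K \<gamma> \<Theta> f"
    and "admissible \<Theta> w" "admissible \<Theta> w'" "velocity w = 0" "velocity w' = 0"
  shows "momentum_part (contract (f w w') a) = avg (pressure K \<gamma> \<Theta> w) (pressure K \<gamma> \<Theta> w') *\<^sub>R a"
  by (rule momentum_contract_diagonal)
    (use assms(1)[unfolded pressure_average_at_rest_def, rule_format, OF assms(2-5)] in simp)

lemma momentum_contract_noncons_volume:
  assumes "noncons_volume_form \<gamma> \<Theta> g" and "admissible \<Theta> w" "admissible \<Theta> w'"
  shows "momentum_part (contract (g w w') a)
    = (gamma_mean \<gamma> (mass_density w) (mass_density w') * jump (geopot w) (geopot w')) *\<^sub>R a"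
  by (rule momentum_contract_diagonal)
    (use assms(1)[unfolded noncons_volume_form_def, rule_format, OF assms(2,3)] in simp)

lemma momentum_contract_noncons_surface:
  assumes "noncons_surface_form \<Theta> g" and "admissible \<Theta> w" "admissible \<Theta> w'"
    and "geopot w' = geopot w"
  shows "momentum_part (contract (g w w') a) = 0"
proof -
  obtain \<mu> :: "real \<Rightarrow> real \<Rightarrow> real" where
    "momentum_part (g w w' d) $ c =
      (if c = d then \<mu> (mass_density w) (mass_density w') * jump (geopot w) (geopot w') else 0)" for c d
    using assms(1-3) unfolding noncons_surface_form_def by blast
  then have "momentum_part (contract (g w w') a) = 0 *\<^sub>R a"
    by (intro momentum_contract_diagonal) (simp add: assms(4) jump_def)
  then show ?thesis by simp
qed

section \<open>Balance along one reference direction\<close>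

text \<open>The volume terms of a grid line: the pressure at the other nodes of the line drops out.\<close>

lemma hydrostatic_volume_terms:
  fixes a :: "nat \<Rightarrow> real^3"
  assumes "inj_on \<xi> {..N}"
    and "K > 0" "\<gamma> > 1" "\<theta> > 0"
    and vol: "noncons_volume_form \<gamma> \<Theta> g" "pressure_average_at_rest K \<gamma> \<Theta> f"
    and w: "hydrostatic K \<gamma> \<Theta> \<theta> \<rho>\<^sub>0 \<phi>\<^sub>0 w"
    and w': "\<And>m. m \<le> N \<Longrightarrow> hydrostatic K \<gamma> \<Theta> \<theta> \<rho>\<^sub>0 \<phi>\<^sub>0 (w' m)"
  shows "momentum_part (- 2 *\<^sub>R (\<Sum>m\<le>N. Qmat N \<xi> i m *\<^sub>R contract (f w (w' m)) (avg b (a m)))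
      - (\<Sum>m\<le>N. Qmat N \<xi> i m *\<^sub>R contract (g w (w' m)) (avg b (a m))))
    = - (pressure K \<gamma> \<Theta> w * lgl_weight N \<xi> i) *\<^sub>R (\<Sum>m\<le>N. Dmat N \<xi> i m *\<^sub>R a m)"
    (is "?lhs = _")
proof -
  let ?p = "pressure K \<gamma> \<Theta> w"
  have node_term: "2 *\<^sub>R momentum_part (contract (f w (w' m)) (avg b (a m)))
      + momentum_part (contract (g w (w' m)) (avg b (a m))) = ?p *\<^sub>R (b + a m)" if "m \<le> N" for m
  proof -
    let ?p' = "pressure K \<gamma> \<Theta> (w' m)"
    have adm: "admissible \<Theta> w" "velocity w = 0" "admissible \<Theta> (w' m)" "velocity (w' m) = 0"
      using hydrostatic_admissible[OF w \<open>\<theta> > 0\<close>] hydrostatic_admissible[OF w'[OF that] \<open>\<theta> > 0\<close>]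
      by auto
    have "2 *\<^sub>R momentum_part (contract (f w (w' m)) (avg b (a m)))
        + momentum_part (contract (g w (w' m)) (avg b (a m)))
        = (2 * avg ?p ?p' - jump ?p ?p') *\<^sub>R avg b (a m)"
      using adm assms w'[OF that]
      by (simp add: momentum_contract_pressure_average[OF vol(2)] momentum_contract_noncons_volume[OF vol(1)]
          gamma_mean_jump_geopot scaleR_left_diff_distrib)
    also have "2 * avg ?p ?p' - jump ?p ?p' = 2 * ?p"
      by (simp add: avg_def jump_def field_simps)
    finally show ?thesis
      by (simp add: avg_def)
  qed
  have "?lhs = - (\<Sum>m\<le>N. Qmat N \<xi> i m *\<^sub>R
      (2 *\<^sub>R momentum_part (contract (f w (w' m)) (avg b (a m)))
        + momentum_part (contract (g w (w' m)) (avg b (a m)))))"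
    by (simp add: momentum_part_simps scaleR_right.sum scaleR_right_distrib sum.distrib
        mult.commute sum_negf)
  also have "\<dots> = - (\<Sum>m\<le>N. Qmat N \<xi> i m *\<^sub>R ?p *\<^sub>R (b + a m))"
    by (simp add: node_term)
  also have "\<dots> = - (?p * lgl_weight N \<xi> i) *\<^sub>R (\<Sum>m\<le>N. Dmat N \<xi> i m *\<^sub>R (b + a m))"
    by (simp add: Qmat_def scaleR_right.sum mult_ac sum_negf)
  also have "(\<Sum>m\<le>N. Dmat N \<xi> i m *\<^sub>R (b + a m))
      = (\<Sum>m\<le>N. Dmat N \<xi> i m) *\<^sub>R b + (\<Sum>m\<le>N. Dmat N \<xi> i m *\<^sub>R a m)"
    by (simp add: scaleR_right_distrib sum.distrib scaleR_left.sum)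
  finally show ?thesis
    by (simp add: sum_Dmat[OF assms(1)])
qed

text \<open>At a face the numerical surface term coincides with the exact flux.\<close>

lemma hydrostatic_surface_term:
  assumes "K > 0" "\<gamma> > 1" "\<theta> > 0"
    and surf: "noncons_surface_form \<Theta> g" "pressure_average_at_rest K \<gamma> \<Theta> f"
    and w: "hydrostatic K \<gamma> \<Theta> \<theta> \<rho>\<^sub>0 \<phi>\<^sub>0 w" "hydrostatic K \<gamma> \<Theta> \<theta> \<rho>\<^sub>0 \<phi>\<^sub>0 w'"
    and "geopot w' = geopot w"
  shows "momentum_part (contract (f w w') (avg b b) + (1/2) *\<^sub>R contract (g w w') (avg b b))
    = momentum_part (contract (euler_flux K \<gamma> \<Theta> f\<^sub>X w) b)"
proof -
  note adm = hydrostatic_admissible[OF w(1) \<open>\<theta> > 0\<close>] hydrostatic_admissible[OF w(2) \<open>\<theta> > 0\<close>]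
  have idem: "avg x x = x" for x :: "'z::real_vector"
    by (simp add: avg_def flip: scaleR_2)
  show ?thesis
    using adm hydrostatic_pressure_eq_if_geopot_eq[OF w assms(1-3,8)] assms(8)
    by (simp add: momentum_part_simps momentum_contract_pressure_average[OF surf(2)]
        momentum_contract_noncons_surface[OF surf(1)] momentum_contract_euler_flux idem)
qed

lemma momentum_dgsem_dir:
  assumes "inj_on \<xi> {..N}"
    and pos: "K > 0" "\<gamma> > 1" "\<theta> > 0"
    and mesh: "conforming_mesh N \<xi> M"
    and surf: "noncons_surface_form \<Theta> (g_surf F)" "pressure_average_at_rest K \<gamma> \<Theta> (f_surf F)"
    and vol: "noncons_volume_form \<gamma> \<Theta> (g_vol F)" "pressure_average_at_rest K \<gamma> \<Theta> (f_vol F)"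
    and hyd: "\<And>e n. e \<in> elements M \<union> {nbr M e r s | e r s. e \<in> elements M} \<Longrightarrow> n \<in> nodes N \<Longrightarrow>
      hydrostatic K \<gamma> \<Theta> \<theta> \<rho>\<^sub>0 \<phi>\<^sub>0 (nodal_values \<xi> M \<phi> u e n)"
    and e: "e \<in> elements M" and n: "n \<in> nodes N"
  shows "momentum_part (dgsem_dir (euler_flux K \<gamma> \<Theta> f\<^sub>X) F N \<xi> M (nodal_values \<xi> M \<phi> u) e r n)
    = - (pressure K \<gamma> \<Theta> (nodal_values \<xi> M \<phi> u e n) * (\<Prod>s\<in>UNIV. lgl_weight N \<xi> (n s)))
        *\<^sub>R (\<Sum>m\<le>N. Dmat N \<xi> (n r) m *\<^sub>R met M e r (n(r := m)))"
proof -
  let ?v = "nodal_values \<xi> M \<phi> u"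
  let ?w = "?v e n"
  let ?exact = "contract (euler_flux K \<gamma> \<Theta> f\<^sub>X ?w) (met M e r n)"
  let ?star = "\<lambda>e' n'. contract (f_surf F ?w (?v e' n')) (avg (met M e r n) (met M e' r n'))
    + (1/2) *\<^sub>R contract (g_surf F ?w (?v e' n')) (avg (met M e r n) (met M e' r n'))"
  have line: "n(r := m) \<in> nodes N" if "m \<le> N" for m
    using n that by (auto simp: nodes_def)
  have w: "hydrostatic K \<gamma> \<Theta> \<theta> \<rho>\<^sub>0 \<phi>\<^sub>0 ?w"
    using hyd e n by blast
  have lower: "momentum_part (?star (nbr M e r Lower) (n(r := N))) = momentum_part ?exact" if "n r = 0"
  proof -
    have glue: "position \<xi> M (nbr M e r Lower) (n(r := N)) = position \<xi> M e n"
      "met M (nbr M e r Lower) r (n(r := N)) = met M e r n"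
      using mesh e n that by (auto simp: conforming_mesh_def)
    have "hydrostatic K \<gamma> \<Theta> \<theta> \<rho>\<^sub>0 \<phi>\<^sub>0 (?v (nbr M e r Lower) (n(r := N)))"
      using hyd[OF _ line] e by blast
    from hydrostatic_surface_term[OF pos surf w this, of "met M e r n"] show ?thesis
      unfolding glue(2) by (simp add: geopot_def nodal_values_def glue(1))
  qed
  have upper: "momentum_part (?star (nbr M e r Upper) (n(r := 0))) = momentum_part ?exact" if "n r = N"
  proof -
    have glue: "position \<xi> M (nbr M e r Upper) (n(r := 0)) = position \<xi> M e n"
      "met M (nbr M e r Upper) r (n(r := 0)) = met M e r n"
      using mesh e n that by (auto simp: conforming_mesh_def)
    have "hydrostatic K \<gamma> \<Theta> \<theta> \<rho>\<^sub>0 \<phi>\<^sub>0 (?v (nbr M e r Upper) (n(r := 0)))"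
      using hyd[OF _ line] e by blast
    from hydrostatic_surface_term[OF pos surf w this, of "met M e r n"] show ?thesis
      unfolding glue(2) by (simp add: geopot_def nodal_values_def glue(1))
  qed
  let ?vol = "- 2 *\<^sub>R (\<Sum>m\<le>N. Qmat N \<xi> (n r) m *\<^sub>R
        contract (f_vol F ?w (?v e (n(r := m)))) (avg (met M e r n) (met M e r (n(r := m)))))
      - (\<Sum>m\<le>N. Qmat N \<xi> (n r) m *\<^sub>R
        contract (g_vol F ?w (?v e (n(r := m)))) (avg (met M e r n) (met M e r (n(r := m)))))"
  have volume: "momentum_part ?vol = - (pressure K \<gamma> \<Theta> ?w * lgl_weight N \<xi> (n r))
      *\<^sub>R (\<Sum>m\<le>N. Dmat N \<xi> (n r) m *\<^sub>R met M e r (n(r := m)))"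
    using hyd e line by (intro hydrostatic_volume_terms[OF assms(1) pos vol w]) auto
  have "momentum_part (dgsem_dir (euler_flux K \<gamma> \<Theta> f\<^sub>X) F N \<xi> M ?v e r n)
      = (\<Prod>s\<in>UNIV - {r}. lgl_weight N \<xi> (n s)) *\<^sub>R (momentum_part ?vol
        - (if n r = 0 then momentum_part ?exact else 0)
        + (if n r = N then momentum_part ?exact else 0)
        + (if n r = 0 then momentum_part (?star (nbr M e r Lower) (n(r := N))) else 0)
        - (if n r = N then momentum_part (?star (nbr M e r Upper) (n(r := 0))) else 0))"
    unfolding dgsem_dir_def Let_def
    by (simp only: momentum_part_simps if_distrib[of momentum_part])
  also have "\<dots> = (\<Prod>s\<in>UNIV - {r}. lgl_weight N \<xi> (n s)) *\<^sub>R momentum_part ?vol"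
    by (simp only: lower upper cong: if_cong) simp
  also have "\<dots> = - (pressure K \<gamma> \<Theta> ?w * (lgl_weight N \<xi> (n r) * (\<Prod>s\<in>UNIV - {r}. lgl_weight N \<xi> (n s))))
        *\<^sub>R (\<Sum>m\<le>N. Dmat N \<xi> (n r) m *\<^sub>R met M e r (n(r := m)))"
    unfolding volume by (simp add: mult_ac)
  also have "lgl_weight N \<xi> (n r) * (\<Prod>s\<in>UNIV - {r}. lgl_weight N \<xi> (n s))
      = (\<Prod>s\<in>UNIV. lgl_weight N \<xi> (n s))"
    by (simp add: prod.remove[of UNIV r])
  finally show ?thesis .
qed

section \<open>Preservation of the hydrostatic balance\<close>

theorem theorem6p5:
  fixes K \<gamma> :: real
    and \<Theta> :: "euler_nodal \<Rightarrow> real"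
    and f\<^sub>X :: "euler_nodal \<Rightarrow> 3 \<Rightarrow> real"
    and F :: "(euler_nodal, euler_state) two_point_fluxes"
    and N :: nat
    and \<xi> :: "nat \<Rightarrow> real"
    and M :: "'e mesh"
    and \<phi> :: "real^3 \<Rightarrow> real"
  assumes "K > 0" and "\<gamma> > 1"
    and "N \<ge> 1" and "lgl_nodes N \<xi>"
    and "conforming_mesh N \<xi> M"
    and "noncons_surface_form \<Theta> (g_surf F)"
    and "noncons_volume_form \<gamma> \<Theta> (g_vol F)"
    and "pressure_average_at_rest K \<gamma> \<Theta> (f_vol F)"
    and "pressure_average_at_rest K \<gamma> \<Theta> (f_surf F)"
    and "metric_identities N \<xi> M"
  shows "preserves_hydrostatic_balance K \<gamma> \<Theta> f\<^sub>X F N \<xi> M \<phi>"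
proof -
  have inj: "inj_on \<xi> {..N}"
    using assms(4) by (auto simp: lgl_nodes_def intro: strict_mono_on_imp_inj_on)
  have sum_zero: "momentum_part (dgsem_sum (euler_flux K \<gamma> \<Theta> f\<^sub>X) F N \<xi> M (nodal_values \<xi> M \<phi> u) e n) = 0"
    if "\<theta> > 0"
      and hyd: "\<forall>e \<in> elements M \<union> {nbr M e r s | e r s. e \<in> elements M}. \<forall>n\<in>nodes N.
        hydrostatic K \<gamma> \<Theta> \<theta> \<rho>\<^sub>0 \<phi>\<^sub>0 (nodal_values \<xi> M \<phi> u e n)"
      and en: "e \<in> elements M" "n \<in> nodes N"
    for \<theta> \<rho>\<^sub>0 \<phi>\<^sub>0 u e n
  proof -
    note dir = momentum_dgsem_dir[OF inj assms(1,2) \<open>\<theta> > 0\<close> assms(5,6,9,7,8) hyd[rule_format] en]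
    have "momentum_part (dgsem_sum (euler_flux K \<gamma> \<Theta> f\<^sub>X) F N \<xi> M (nodal_values \<xi> M \<phi> u) e n)
        = - (pressure K \<gamma> \<Theta> (nodal_values \<xi> M \<phi> u e n) * (\<Prod>s\<in>UNIV. lgl_weight N \<xi> (n s)))
          *\<^sub>R (\<Sum>r\<in>UNIV. \<Sum>m\<le>N. Dmat N \<xi> (n r) m *\<^sub>R met M e r (n(r := m)))"
      by (simp only: dgsem_sum_def momentum_part_simps dir scaleR_right.sum)
    also have "(\<Sum>r\<in>UNIV. \<Sum>m\<le>N. Dmat N \<xi> (n r) m *\<^sub>R met M e r (n(r := m))) = 0"
      using assms(10) en by (auto simp: metric_identities_def)
    finally show ?thesis by simp
  qed
  then show ?thesis
    by (auto simp: preserves_hydrostatic_balance_def dgsem_rate_def momentum_part_simps)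
qed

end
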